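(* Let $q$ be a prime power and $e\ge 2$ an integer. The bilinear forms graph $H_q(2,e)$ is triply transitive if and only if $q=e=2$.
   Context: $H_q(2,e)$ has as vertices the $2\times e$ matrices over $\mathbb F_q$, two matrices being adjacent iff their difference has rank $1$. For a strongly regular graph $\Gamma=(V,E)$: $A_0=I$, $A_1$ its adjacency matrix, $A_2=J-I-A_1$; for a vertex $\omega$, $E^*_{i,\omega}$ ($i=0,1,2$) is the diagonal matrix whose diagonal is the $\omega$-row of $A_i$; $T_\omega$ is the algebra generated by $A_0,A_1,A_2,E^*_{0,\omega},E^*_{1,\omega},E^*_{2,\omega}$; $T_{0,\omega}$ is the span of all $E^*_{i,\omega}A_jE^*_{k,\omega}$; $\tilde T_\omega$ is the algebra of complex matrices commuting with the permutation matrices of the stabilizer $G_\omega$ in $G=\mathrm{Aut}(\Gamma)$. $\Gamma$ is triply transitive if $G$ is transitive and $T_{0,\omega}=T_\omega=\tilde T_\omega$ for some (equivalently every) vertex $\omega$. *)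

theory Defs
  imports "HOL-Analysis.Analysis" "HOL-Number_Theory.Prime_Powers"
begin

(* A graph is a symmetric irreflexive relation on a finite type of vertices; matrices with
   rows and columns indexed by the vertices have type complex ^ 'v ^ 'v. *)

type_synonym 'v cmat = "complex ^ 'v ^ 'v"

(* As the library has no complex scalar action on complex ^ 'v ^ 'v, it is introduced here;
   the interpretation supplies cmat.span and cmat.subspace over the complex numbers. *)

definition scale_cmat :: "complex \<Rightarrow> 'v::finite cmat \<Rightarrow> 'v cmat" where
  "scale_cmat c M = (\<chi> x y. c * M $ x $ y)"

interpretation cmat: vector_space "scale_cmat :: complex \<Rightarrow> 'v::finite cmat \<Rightarrow> 'v cmat"
  by unfold_locales (simp_all add: scale_cmat_def vec_eq_iff algebra_simps)

(* Complete and edgeless graphs are excluded, as usual. *)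

definition strongly_regular :: "('v::finite \<Rightarrow> 'v \<Rightarrow> bool) \<Rightarrow> bool" where
  "strongly_regular E \<longleftrightarrow>
     symp E \<and> irreflp E \<and>
     (\<exists>k l m. 0 < k \<and> k + 1 < CARD('v) \<and>
       (\<forall>x. card {z. E x z} = k) \<and>
       (\<forall>x y. E x y \<longrightarrow> card {z. E x z \<and> E y z} = l) \<and>
       (\<forall>x y. x \<noteq> y \<and> \<not> E x y \<longrightarrow> card {z. E x z \<and> E y z} = m))"

definition adj_matrix :: "('v::finite \<Rightarrow> 'v \<Rightarrow> bool) \<Rightarrow> 'v cmat" where
  "adj_matrix E = (\<chi> x y. if E x y then 1 else 0)"

definition all_ones :: "'v::finite cmat" where
  "all_ones = (\<chi> x y. 1)"

(* A_i for i = 0, 1, 2; only these three indices are ever used. *)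

definition assoc_matrix :: "('v::finite \<Rightarrow> 'v \<Rightarrow> bool) \<Rightarrow> nat \<Rightarrow> 'v cmat" where
  "assoc_matrix E i =
     (if i = 0 then mat 1
      else if i = 1 then adj_matrix E
      else all_ones - mat 1 - adj_matrix E)"

definition dual_idempotent :: "('v::finite \<Rightarrow> 'v \<Rightarrow> bool) \<Rightarrow> 'v \<Rightarrow> nat \<Rightarrow> 'v cmat" where
  "dual_idempotent E w i = (\<chi> x y. if x = y then assoc_matrix E i $ w $ x else 0)"

definition is_matrix_algebra :: "'v::finite cmat set \<Rightarrow> bool" where
  "is_matrix_algebra S \<longleftrightarrow>
     cmat.subspace S \<and> mat 1 \<in> S \<and> (\<forall>M\<in>S. \<forall>N\<in>S. M ** N \<in> S)"

definition generated_algebra :: "'v::finite cmat set \<Rightarrow> 'v cmat set" where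
  "generated_algebra X = \<Inter> {S. is_matrix_algebra S \<and> X \<subseteq> S}"

definition terwilliger_algebra :: "('v::finite \<Rightarrow> 'v \<Rightarrow> bool) \<Rightarrow> 'v \<Rightarrow> 'v cmat set" where
  "terwilliger_algebra E w =
     generated_algebra (assoc_matrix E ` {0, 1, 2} \<union> dual_idempotent E w ` {0, 1, 2})"

definition terwilliger_T0 :: "('v::finite \<Rightarrow> 'v \<Rightarrow> bool) \<Rightarrow> 'v \<Rightarrow> 'v cmat set" where
  "terwilliger_T0 E w =
     cmat.span {dual_idempotent E w i ** assoc_matrix E j ** dual_idempotent E w k | i j k.
       i \<in> {0, 1, 2} \<and> j \<in> {0, 1, 2} \<and> k \<in> {0, 1, 2}}"

definition graph_automorphisms :: "('v \<Rightarrow> 'v \<Rightarrow> bool) \<Rightarrow> ('v \<Rightarrow> 'v) set" where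
  "graph_automorphisms E = {g. bij g \<and> (\<forall>x y. E (g x) (g y) \<longleftrightarrow> E x y)}"

definition vertex_stabilizer :: "('v \<Rightarrow> 'v \<Rightarrow> bool) \<Rightarrow> 'v \<Rightarrow> ('v \<Rightarrow> 'v) set" where
  "vertex_stabilizer E w = {g \<in> graph_automorphisms E. g w = w}"

definition permutation_matrix :: "('v::finite \<Rightarrow> 'v) \<Rightarrow> 'v cmat" where
  "permutation_matrix g = (\<chi> x y. if x = g y then 1 else 0)"

definition centralizer_algebra :: "('v::finite \<Rightarrow> 'v \<Rightarrow> bool) \<Rightarrow> 'v \<Rightarrow> 'v cmat set" where
  "centralizer_algebra E w =
     {M. \<forall>g\<in>vertex_stabilizer E w. permutation_matrix g ** M = M ** permutation_matrix g}"

(* Triple transitivity is a notion for strongly regular graphs only, hence the first conjunct. *)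

definition triply_transitive :: "('v::finite \<Rightarrow> 'v \<Rightarrow> bool) \<Rightarrow> bool" where
  "triply_transitive E \<longleftrightarrow>
     strongly_regular E \<and>
     (\<forall>x y. \<exists>g\<in>graph_automorphisms E. g x = y) \<and>
     (\<exists>w. terwilliger_T0 E w = terwilliger_algebra E w \<and>
          terwilliger_algebra E w = centralizer_algebra E w)"

(* In 'a ^ 'e ^ 2 the outer index 2 counts the rows: 2 x CARD('e) matrices over 'a.
   The constant rank is the dimension of the row space over 'a. *)

definition bilinear_forms_graph ::
    "'a::{field,finite} ^ 'e::finite ^ 2 \<Rightarrow> 'a ^ 'e ^ 2 \<Rightarrow> bool" where
  "bilinear_forms_graph X Y \<longleftrightarrow> rank (X - Y) = 1"

end

theory Submission
  imports Defs
begin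

text \<open>Elements of \<open>T\<^sub>0\<close> have entries \<open>M $ x $ y\<close> depending only on the three relations within
  \<open>(w, x, y)\<close>. If \<open>T\<^sub>0 = T\<close>, this applies to \<open>A\<^sub>1 E\<^sup>*\<^sub>1 A\<^sub>1\<close>, so all triangles have the same number
  of common neighbours. In \<open>H\<^sub>q(2,e)\<close> a triangle of matrices with a common column space has
  \<open>q\<^sup>e - 3\<close> common neighbours, one with a common row space \<open>q\<^sup>2 - 3\<close>, and, if \<open>q > 2\<close>, one inside
  a line over the field more than \<open>q\<^sup>e - 3\<close>. Hence \<open>e = 2\<close> and \<open>q = 2\<close>.

  Conversely \<open>H\<^sub>2(2,2)\<close> is the complement of the \<open>4 \<times> 4\<close> rook's graph, where row permutations,
  column permutations and the transposition move any triple of vertices to any other triple with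
  the same relations; then \<open>T\<^sub>0\<close> contains the centralizer algebra of the stabilizer.\<close>

subsection \<open>Triple transitivity in terms of triples of vertices\<close>

text \<open>For irreflexive \<open>E\<close> this is the index of the only matrix among A_0, A_1,
  A_2 with entry 1 at the pair. Three such indices form the type of a triple
  \<open>(w, x, y)\<close>.\<close>

definition rel_index :: "('v \<Rightarrow> 'v \<Rightarrow> bool) \<Rightarrow> 'v \<Rightarrow> 'v \<Rightarrow> nat" where
  "rel_index E x y = (if x = y then 0 else if E x y then 1 else 2)"

lemma rel_index_in: "rel_index E x y \<in> {0, 1, 2}"
  by (simp add: rel_index_def)

lemma rel_index_eq_iff:
  "rel_index E x y = rel_index E x' y' \<longleftrightarrow>
    (x = y \<longleftrightarrow> x' = y') \<and> (x \<noteq> y \<longrightarrow> (E x y \<longleftrightarrow> E x' y'))"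
  by (auto simp: rel_index_def)

lemma assoc_matrix_entry:
  assumes "irreflp E" "i \<in> {0, 1, 2}"
  shows "assoc_matrix E i $ x $ y = (if i = rel_index E x y then 1 else 0)"
  using assms
  by (auto simp: assoc_matrix_def rel_index_def adj_matrix_def all_ones_def mat_def irreflp_def)

lemma dual_idempotent_mult_left:
  "(dual_idempotent E w i ** M) $ x $ y = assoc_matrix E i $ w $ x * M $ x $ y"
  by (simp add: matrix_matrix_mult_def dual_idempotent_def if_distrib[of "\<lambda>t. t * _"]
      cong: if_cong)

lemma dual_idempotent_mult_right:
  "(M ** dual_idempotent E w i) $ x $ y = M $ x $ y * assoc_matrix E i $ w $ y"
  by (simp add: matrix_matrix_mult_def dual_idempotent_def if_distrib[of "\<lambda>t. _ * t"]
      cong: if_cong)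

text \<open>The diagonal factors keep the rows in relation \<open>i\<close> and the columns in
  relation \<open>k\<close> to \<open>w\<close>. Thus each generator is the indicator matrix of one
  type of triple, and is zero if that type does not occur.\<close>

lemma T0_generator_entry:
  assumes "irreflp E" "i \<in> {0, 1, 2}" "j \<in> {0, 1, 2}" "k \<in> {0, 1, 2}"
  shows "(dual_idempotent E w i ** assoc_matrix E j ** dual_idempotent E w k) $ x $ y =
    (if i = rel_index E w x \<and> j = rel_index E x y \<and> k = rel_index E w y then 1 else 0)"
  unfolding dual_idempotent_mult_left dual_idempotent_mult_right
    assoc_matrix_entry[OF assms(1,2)] assoc_matrix_entry[OF assms(1,3)]
    assoc_matrix_entry[OF assms(1,4)]
  by simp

text \<open>Equality of two fixed entries is a linear condition, so it suffices to check it on the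
  generators.\<close>

lemma T0_entry_cong:
  assumes "irreflp E" "M \<in> terwilliger_T0 E w"
    and "rel_index E w x = rel_index E w x'" "rel_index E x y = rel_index E x' y'"
      "rel_index E w y = rel_index E w y'"
  shows "M $ x $ y = M $ x' $ y'"
  using assms(2) unfolding terwilliger_T0_def
proof (rule cmat.span_induct)
  show "cmat.subspace {M. M $ x $ y = M $ x' $ y'}"
    by (auto simp: cmat.subspace_def scale_cmat_def)
next
  fix N
  assume "N \<in> {dual_idempotent E w i ** assoc_matrix E j ** dual_idempotent E w k | i j k.
       i \<in> {0, 1, 2} \<and> j \<in> {0, 1, 2} \<and> k \<in> {0, 1, 2}}"
  then obtain i j k where N: "N = dual_idempotent E w i ** assoc_matrix E j ** dual_idempotent E w k"
    and ijk: "i \<in> {0, 1, 2}" "j \<in> {0, 1, 2}" "k \<in> {0, 1, 2}"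
    by blast
  show "N $ x $ y = N $ x' $ y'"
    unfolding N T0_generator_entry[OF assms(1) ijk] assms(3-5) ..
qed

text \<open>Conversely, a matrix whose entries depend only on the type is the combination of the
  indicator matrices with coefficients \<open>c\<close>.\<close>

lemma T0_memI:
  fixes M :: "'v::finite cmat"
  assumes irr: "irreflp E"
    and M: "\<And>x y. M $ x $ y = c (rel_index E w x) (rel_index E x y) (rel_index E w y)"
  shows "M \<in> terwilliger_T0 E w"
proof -
  let ?I = "{0, 1, 2::nat}"
  let ?N = "\<lambda>i j k. dual_idempotent E w i ** assoc_matrix E j ** dual_idempotent E w k"
  let ?S = "\<Sum>i\<in>?I. \<Sum>j\<in>?I. \<Sum>k\<in>?I. scale_cmat (c i j k) (?N i j k)"
  have "?S $ x $ y = M $ x $ y" for x y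
  proof -
    have "?S $ x $ y = (\<Sum>i\<in>?I. \<Sum>j\<in>?I. \<Sum>k\<in>?I. c i j k * ?N i j k $ x $ y)"
      by (simp add: sum_component scale_cmat_def del: sum.insert)
    also have "\<dots> = (\<Sum>i\<in>?I. \<Sum>j\<in>?I. \<Sum>k\<in>?I. c i j k *
        (if i = rel_index E w x \<and> j = rel_index E x y \<and> k = rel_index E w y then 1 else 0))"
      by (intro sum.cong refl) (simp only: T0_generator_entry[OF irr])
    also have "\<dots> = c (rel_index E w x) (rel_index E x y) (rel_index E w y)"
      using rel_index_in[of E w x] rel_index_in[of E x y] rel_index_in[of E w y]
      by (elim insertE emptyE) simp_all
    finally show ?thesis by (simp only: M)
  qed
  then have "M = ?S" by (simp add: vec_eq_iff)
  moreover have "?S \<in> terwilliger_T0 E w"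
    unfolding terwilliger_T0_def
    by (intro cmat.span_sum cmat.span_scale cmat.span_base) blast
  ultimately show ?thesis by simp
qed

section \<open>The Terwilliger algebra as a generated algebra\<close>

lemma is_matrix_algebra_generated: "is_matrix_algebra (generated_algebra X)"
  unfolding generated_algebra_def is_matrix_algebra_def cmat.subspace_def by blast

lemma generated_algebra_base: "M \<in> X \<Longrightarrow> M \<in> generated_algebra X"
  unfolding generated_algebra_def by blast

lemma generated_algebra_minimal: "is_matrix_algebra S \<Longrightarrow> X \<subseteq> S \<Longrightarrow> generated_algebra X \<subseteq> S"
  unfolding generated_algebra_def by blast

lemma terwilliger_algebra_base:
  assumes "i \<in> {0, 1, 2}"
  shows "assoc_matrix E i \<in> terwilliger_algebra E w" "dual_idempotent E w i \<in> terwilliger_algebra E w"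
  using assms unfolding terwilliger_algebra_def by (blast intro: generated_algebra_base)+

lemma terwilliger_algebra_mult:
  "M \<in> terwilliger_algebra E w \<Longrightarrow> N \<in> terwilliger_algebra E w \<Longrightarrow> M ** N \<in> terwilliger_algebra E w"
  using is_matrix_algebra_generated unfolding terwilliger_algebra_def is_matrix_algebra_def by blast

lemma T0_subset_terwilliger_algebra: "terwilliger_T0 E w \<subseteq> terwilliger_algebra E w"
  unfolding terwilliger_T0_def
proof (rule cmat.span_minimal)
  show "cmat.subspace (terwilliger_algebra E w)"
    using is_matrix_algebra_generated unfolding terwilliger_algebra_def is_matrix_algebra_def by blast
qed (auto intro!: terwilliger_algebra_mult terwilliger_algebra_base)

section \<open>The centralizer algebra of the vertex stabilizer\<close>

lemma permutation_matrix_commute_iff: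
  fixes M :: "'v::finite cmat"
  assumes "bij g"
  shows "permutation_matrix g ** M = M ** permutation_matrix g \<longleftrightarrow>
    (\<forall>x y. M $ g x $ g y = M $ x $ y)"
proof -
  have inj: "g a = g b \<longleftrightarrow> a = b" for a b
    using assms by (auto simp: bij_def inj_def)
  have l: "(permutation_matrix g ** M) $ g x $ y = M $ x $ y" for x y
    by (simp add: matrix_matrix_mult_def permutation_matrix_def inj if_distrib[of "\<lambda>t. t * _"]
      cong: if_cong)
  have r: "(M ** permutation_matrix g) $ x $ y = M $ x $ g y" for x y
    by (simp add: matrix_matrix_mult_def permutation_matrix_def if_distrib[of "\<lambda>t. _ * t"]
      cong: if_cong)
  have "permutation_matrix g ** M = M ** permutation_matrix g \<longleftrightarrow>
    (\<forall>x y. (permutation_matrix g ** M) $ x $ y = (M ** permutation_matrix g) $ x $ y)"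
    by (simp add: vec_eq_iff)
  \<comment> \<open>Since \<open>g\<close> is surjective, only rows of the form \<open>g x\<close>
    need be compared; there both products reduce to a single entry of \<open>M\<close>.\<close>
  also have "\<dots> \<longleftrightarrow> (\<forall>x y. (permutation_matrix g ** M) $ g x $ y = (M ** permutation_matrix g) $ g x $ y)"
    using assms by (metis bij_pointE)
  finally show ?thesis unfolding l r by metis
qed

lemma centralizer_algebra_iff:
  "M \<in> centralizer_algebra E w \<longleftrightarrow>
    (\<forall>g\<in>vertex_stabilizer E w. \<forall>x y. M $ g x $ g y = M $ x $ y)"
  unfolding centralizer_algebra_def
  by (auto simp: permutation_matrix_commute_iff vertex_stabilizer_def graph_automorphisms_def)

text \<open>Invariance of entries under \<open>g\<close> passes to products by substituting
  \<open>g z\<close> for the summation index.\<close>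

lemma is_matrix_algebra_centralizer: "is_matrix_algebra (centralizer_algebra E w)"
proof -
  have "(M ** N) $ g x $ g y = (M ** N) $ x $ y"
    if "bij g" "\<And>x y. M $ g x $ g y = M $ x $ y" "\<And>x y. N $ g x $ g y = N $ x $ y"
    for M N :: "'a::finite cmat" and g x y
  proof -
    have "(M ** N) $ g x $ g y = (\<Sum>z\<in>UNIV. M $ g x $ g z * N $ g z $ g y)"
      unfolding matrix_matrix_mult_def
      using sum.reindex_bij_betw[OF \<open>bij g\<close>, of "\<lambda>z. M $ g x $ z * N $ z $ g y"] by simp
    then show ?thesis by (simp add: that matrix_matrix_mult_def)
  qed
  moreover have "(mat 1 :: 'a cmat) $ g x $ g y = mat 1 $ x $ y" if "bij g" for g and x y :: 'a
    using that by (auto simp: mat_def bij_def inj_def)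
  ultimately show ?thesis
    unfolding is_matrix_algebra_def cmat.subspace_def centralizer_algebra_iff
    by (auto simp: scale_cmat_def vertex_stabilizer_def graph_automorphisms_def centralizer_algebra_iff)
qed

lemma rel_index_automorphism:
  "g \<in> graph_automorphisms E \<Longrightarrow> rel_index E (g x) (g y) = rel_index E x y"
  unfolding graph_automorphisms_def rel_index_def by (auto dest: bij_is_inj injD)

text \<open>Automorphisms preserve the three relations, and those fixing \<open>w\<close> also
  preserve the relation of a vertex to \<open>w\<close>. Hence all generators are invariant.\<close>

lemma terwilliger_algebra_subset_centralizer:
  assumes "irreflp E"
  shows "terwilliger_algebra E w \<subseteq> centralizer_algebra E w"
  unfolding terwilliger_algebra_def
proof (rule generated_algebra_minimal[OF is_matrix_algebra_centralizer], rule subsetI)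
  fix M
  assume "M \<in> assoc_matrix E ` {0, 1, 2} \<union> dual_idempotent E w ` {0, 1, 2}"
  then obtain i where i: "i \<in> {0, 1, 2}" and M: "M = assoc_matrix E i \<or> M = dual_idempotent E w i"
    by blast
  have inv: "assoc_matrix E i $ g x $ g y = assoc_matrix E i $ x $ y"
    if "g \<in> graph_automorphisms E" for g x y
    using that by (simp only: assoc_matrix_entry[OF assms i] rel_index_automorphism)
  show "M \<in> centralizer_algebra E w"
    unfolding centralizer_algebra_iff
  proof (intro ballI allI)
    fix g x y
    assume "g \<in> vertex_stabilizer E w"
    then have g: "g \<in> graph_automorphisms E" "g w = w"
      by (auto simp: vertex_stabilizer_def)
    then have "g x = g y \<longleftrightarrow> x = y"
      by (auto simp: graph_automorphisms_def dest: bij_is_inj injD)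
    then show "M $ g x $ g y = M $ x $ y"
      using M inv[OF g(1), of x y] inv[OF g(1), of w x] g(2)
      by (auto simp: dual_idempotent_def)
  qed
qed

section \<open>Triple transitivity through types of triples\<close>

text \<open>The inclusions of T_0 in T and of T in the centralizer algebra are already known. If the
  stabilizer of \<open>w\<close> is transitive on the pairs of each type, invariant matrices depend
  only on the type, which closes the circle.\<close>

lemma triply_transitiveI:
  fixes E :: "'v::finite \<Rightarrow> 'v \<Rightarrow> bool"
  assumes srg: "strongly_regular E"
    and trans: "\<And>x y. \<exists>g\<in>graph_automorphisms E. g x = y"
    and stab: "\<And>x y x' y'. rel_index E w x = rel_index E w x' \<Longrightarrow>
      rel_index E x y = rel_index E x' y' \<Longrightarrow> rel_index E w y = rel_index E w y' \<Longrightarrow>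
      \<exists>g\<in>vertex_stabilizer E w. g x = x' \<and> g y = y'"
  shows "triply_transitive E"
proof -
  have irr: "irreflp E" using srg by (simp add: strongly_regular_def)
  have "centralizer_algebra E w \<subseteq> terwilliger_T0 E w"
  proof
    fix M assume M: "M \<in> centralizer_algebra E w"
    let ?t = "\<lambda>(x, y). (rel_index E w x, rel_index E x y, rel_index E w y)"
    \<comment> \<open>\<open>r\<close> picks a representative pair of each type, and
      \<open>c\<close> reads the entry of \<open>M\<close> there. At types that do not occur the
      value is arbitrary but never consulted.\<close>
    define r where "r = inv ?t"
    define c where "c i j k = (case r (i, j, k) of (x, y) \<Rightarrow> M $ x $ y)" for i j k
    have "M $ x $ y = c (rel_index E w x) (rel_index E x y) (rel_index E w y)" for x y
    proof -
      obtain x' y' where r: "r (?t (x, y)) = (x', y')" by fastforce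
      have "?t (r (?t (x, y))) = ?t (x, y)"
        unfolding r_def by (rule f_inv_into_f) blast
      then obtain g where "g \<in> vertex_stabilizer E w" "g x = x'" "g y = y'"
        using stab[of x x' y y'] unfolding r by auto
      then have "M $ x' $ y' = M $ x $ y"
        using M unfolding centralizer_algebra_iff by blast
      then show ?thesis using r by (simp add: c_def)
    qed
    then show "M \<in> terwilliger_T0 E w" by (rule T0_memI[OF irr])
  qed
  then show ?thesis
    using srg trans T0_subset_terwilliger_algebra[of E w] terwilliger_algebra_subset_centralizer[OF irr, of w]
    unfolding triply_transitive_def by blast
qed

text \<open>The entries of A_1 E*_1 A_1 count the common neighbours of \<open>w\<close>,
  \<open>x\<close> and \<open>y\<close>. This matrix lies in T, hence in T_0, so the count depends
  only on the type of the triple.\<close>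

lemma triply_transitive_card_common_neighbours:
  fixes E :: "'v::finite \<Rightarrow> 'v \<Rightarrow> bool"
  assumes "triply_transitive E"
  obtains w where "\<And>x y x' y'. rel_index E w x = rel_index E w x' \<Longrightarrow>
      rel_index E x y = rel_index E x' y' \<Longrightarrow> rel_index E w y = rel_index E w y' \<Longrightarrow>
      card {z. E w z \<and> E x z \<and> E y z} = card {z. E w z \<and> E x' z \<and> E y' z}"
proof -
  from assms obtain w where w: "terwilliger_T0 E w = terwilliger_algebra E w"
    and irr: "irreflp E" and sym: "symp E"
    unfolding triply_transitive_def strongly_regular_def by blast
  let ?M = "assoc_matrix E 1 ** (dual_idempotent E w 1 ** assoc_matrix E 1)"
  have "?M \<in> terwilliger_T0 E w"
    unfolding w by (intro terwilliger_algebra_mult terwilliger_algebra_base) auto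
  note cong = T0_entry_cong[OF irr this]
  have entry: "?M $ x $ y = of_nat (card {z. E w z \<and> E x z \<and> E y z})" for x y
  proof -
    have "?M $ x $ y = (\<Sum>z\<in>UNIV. assoc_matrix E 1 $ x $ z *
        (assoc_matrix E 1 $ w $ z * assoc_matrix E 1 $ z $ y))"
      by (subst matrix_matrix_mult_def) (simp only: dual_idempotent_mult_left vec_lambda_beta)
    also have "\<dots> = (\<Sum>z\<in>UNIV. if E w z \<and> E x z \<and> E y z then 1 else 0)"
      using sym by (intro sum.cong) (auto simp: assoc_matrix_def adj_matrix_def symp_def)
    also have "\<dots> = of_nat (card {z. E w z \<and> E x z \<and> E y z})"
      by (simp add: sum.If_cases)
    finally show ?thesis .
  qed
  show ?thesis
  proof (rule that)
    fix x y x' y'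
    assume "rel_index E w x = rel_index E w x'" "rel_index E x y = rel_index E x' y'"
      "rel_index E w y = rel_index E w y'"
    from cong[OF this]
    show "card {z. E w z \<and> E x z \<and> E y z} = card {z. E w z \<and> E x' z \<and> E y' z}"
      unfolding entry of_nat_eq_iff .
  qed
qed

subsection \<open>Complements of square rook's graphs\<close>

text \<open>The equality patterns agree, so the partial map on the three points is well defined and
  injective. By finiteness the complements of its domain and range are equally large, which allows
  an extension.\<close>

lemma ex_bij_extending_triple:
  fixes a b c :: "'s::finite"
  assumes "a = b \<longleftrightarrow> a' = b'" "b = c \<longleftrightarrow> b' = c'" "a = c \<longleftrightarrow> a' = c'"
  obtains h where "bij h" "h a = a'" "h b = b'" "h c = (c'::'s)"
proof -
  define h0 where "h0 x = (if x = a then a' else if x = b then b' else c')" for x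
  have h0: "h0 a = a'" "h0 b = b'" "h0 c = c'" using assms by (auto simp: h0_def)
  have bij0: "bij_betw h0 {a, b, c} {a', b', c'}"
    unfolding bij_betw_def inj_on_def using assms h0 by auto
  then have "card {a, b, c} = card {a', b', c'}" by (rule bij_betw_same_card)
  then have "card (- {a, b, c}) = card (- {a', b', c'})"
    by (simp add: Compl_eq_Diff_UNIV card_Diff_subset)
  then obtain h1 where bij1: "bij_betw h1 (- {a, b, c}) (- {a', b', c'})"
    using finite_same_card_bij by (metis finite)
  let ?h = "\<lambda>x. if x \<in> {a, b, c} then h0 x else h1 x"
  have "bij_betw ?h ({a, b, c} \<union> - {a, b, c}) ({a', b', c'} \<union> - {a', b', c'})"
    by (rule bij_betw_disjoint_Un[OF bij0 bij1]) auto
  then have "bij ?h" by simp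
  with h0 show ?thesis by (intro that[of ?h]) auto
qed

text \<open>The coordinates \<open>f\<close> and \<open>g\<close> identify the vertices with the
  cells of a square grid. Permutations of either coordinate, and the exchange of the two, act
  transitively on the triples of each type.\<close>

lemma triply_transitive_rook_complement:
  fixes E :: "'v::finite \<Rightarrow> 'v \<Rightarrow> bool" and f g :: "'v \<Rightarrow> 's::finite"
  assumes bij: "bij (\<lambda>x. (f x, g x))"
    and E: "\<And>x y. E x y \<longleftrightarrow> f x \<noteq> f y \<and> g x \<noteq> g y"
    and card: "2 \<le> CARD('s)"
  shows "triply_transitive E"
proof -
  have eq: "x = y \<longleftrightarrow> f x = f y \<and> g x = g y" for x y
    using bij by (auto simp: bij_def inj_def)
  have ex: "\<exists>x. f x = a \<and> g x = b" for a b
    using surjD[OF bij_is_surj[OF bij], of "(a, b)"] by auto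
  have card_fg: "card {z. f z \<in> A \<and> g z \<in> B} = card A * card B" for A B
  proof -
    have "bij_betw (\<lambda>x. (f x, g x)) {z. f z \<in> A \<and> g z \<in> B} (A \<times> B)"
      unfolding bij_betw_def inj_on_def
    proof (intro conjI ballI impI set_eqI iffI)
      fix p assume "p \<in> A \<times> B"
      then show "p \<in> (\<lambda>x. (f x, g x)) ` {z. f z \<in> A \<and> g z \<in> B}"
        using ex[of "fst p" "snd p"] by (force simp: image_iff)
    qed (use eq in auto)
    then show ?thesis by (simp add: bij_betw_same_card[of _ _ "A \<times> B"] card_cartesian_product)
  qed
  \<comment> \<open>This one product formula yields all parameters of strong regularity; the case
    \<open>x = y\<close> is the valency.\<close>
  have common: "card {z. E x z \<and> E y z} = card (- {f x, f y}) * card (- {g x, g y})" for x y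
    unfolding card_fg[symmetric] by (rule arg_cong[where f=card]) (auto simp: E)
  let ?n = "CARD('s)"
  have srg: "strongly_regular E"
    unfolding strongly_regular_def
  proof (intro conjI exI allI impI)
    show "symp E" "irreflp E" by (auto simp: symp_def irreflp_def E)
    show "0 < (?n - 1) * (?n - 1)" using card by simp
    have "CARD('v) = ?n * ?n" using card_fg[of UNIV UNIV] by simp
    moreover obtain m where "?n = m + 2" using card by (metis add.commute le_Suc_ex)
    ultimately show "(?n - 1) * (?n - 1) + 1 < CARD('v)" by simp
    show "card {z. E x z} = (?n - 1) * (?n - 1)" for x
      using common[of x x] by (simp add: Compl_eq_Diff_UNIV card_Diff_subset)
    show "card {z. E x z \<and> E y z} = (?n - 2) * (?n - 2)" if "E x y" for x y
      using that common[of x y] by (simp add: E Compl_eq_Diff_UNIV card_Diff_subset numeral_2_eq_2)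
    show "card {z. E x z \<and> E y z} = (?n - 2) * (?n - 1)" if "x \<noteq> y \<and> \<not> E x y" for x y
      using that common[of x y] unfolding E eq[of x y] by (auto simp: Compl_eq_Diff_UNIV card_Diff_subset numeral_2_eq_2)
  qed
  \<comment> \<open>Permutations of the two coordinates preserve adjacency because injective maps
    preserve disagreement.\<close>
  have direct: "\<exists>k\<in>graph_automorphisms E. \<forall>x. f (k x) = s (f x) \<and> g (k x) = t (g x)"
    if "bij s" "bij t" for s t
  proof -
    have "\<forall>x. \<exists>y. f y = s (f x) \<and> g y = t (g x)" using ex by blast
    from choice[OF this] obtain k where k: "\<And>x. f (k x) = s (f x)" "\<And>x. g (k x) = t (g x)"
      by blast
    have st: "s a = s b \<longleftrightarrow> a = b" "t a = t b \<longleftrightarrow> a = b" for a b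
      using that by (simp_all add: bij_is_inj inj_eq)
    have "inj k"
    proof (rule injI)
      fix x y assume "k x = k y"
      then show "x = y" using k[of x] k[of y] by (simp add: eq[of x y] st)
    qed
    then have "bij k" by (simp add: bij_def finite_UNIV_inj_surj)
    with k st show ?thesis by (auto simp: graph_automorphisms_def E)
  qed
  \<comment> \<open>The transposition of the grid, which exists because both coordinates take values
    in the same type.\<close>
  have "\<forall>x. \<exists>y. f y = g x \<and> g y = f x" using ex by blast
  from choice[OF this] obtain sw where sw: "\<And>x. f (sw x) = g x" "\<And>x. g (sw x) = f x"
    by blast
  have "inj sw"
  proof (rule injI)
    fix x y assume "sw x = sw y"
    then show "x = y" using sw[of x] sw[of y] by (simp add: eq[of x y])
  qed
  then have "bij sw" by (simp add: bij_def finite_UNIV_inj_surj)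
  then have sw_aut: "sw \<in> graph_automorphisms E" by (auto simp: graph_automorphisms_def E sw)
  have comp: "k \<circ> l \<in> graph_automorphisms E"
    if "k \<in> graph_automorphisms E" "l \<in> graph_automorphisms E" for k l
    using that by (auto simp: graph_automorphisms_def bij_comp)
  \<comment> \<open>When the equality patterns agree for \<open>f\<close> and for \<open>g\<close>
    separately, the two coordinate permutations can be chosen independently.\<close>
  have triple: "\<exists>k\<in>graph_automorphisms E. k w1 = w2 \<and> k x1 = x2 \<and> k y1 = y2"
    if pat: "f w1 = f x1 \<longleftrightarrow> f w2 = f x2" "f x1 = f y1 \<longleftrightarrow> f x2 = f y2" "f w1 = f y1 \<longleftrightarrow> f w2 = f y2"
      "g w1 = g x1 \<longleftrightarrow> g w2 = g x2" "g x1 = g y1 \<longleftrightarrow> g x2 = g y2" "g w1 = g y1 \<longleftrightarrow> g w2 = g y2"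
    for w1 x1 y1 w2 x2 y2
  proof -
    obtain s where s: "bij s" "s (f w1) = f w2" "s (f x1) = f x2" "s (f y1) = f y2"
      using ex_bij_extending_triple[OF pat(1-3)] .
    obtain t where t: "bij t" "t (g w1) = g w2" "t (g x1) = g x2" "t (g y1) = g y2"
      using ex_bij_extending_triple[OF pat(4-6)] .
    from direct[OF s(1) t(1)] obtain k where
      k: "k \<in> graph_automorphisms E" "\<And>x. f (k x) = s (f x)" "\<And>x. g (k x) = t (g x)"
      by blast
    have "k w1 = w2 \<and> k x1 = x2 \<and> k y1 = y2"
      unfolding eq k using s t by simp
    with k(1) show ?thesis by blast
  qed
  show ?thesis
  proof (rule triply_transitiveI[OF srg])
    fix x y
    show "\<exists>k\<in>graph_automorphisms E. k x = y"
      \<comment> \<open>The instance maps the constant triple \<open>(x, x, x)\<close> to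
        \<open>(y, y, y)\<close>.\<close>
      using triple[of x x y y x y] by simp
  next
    fix w x y x' y' :: 'v
    assume types: "rel_index E w x = rel_index E w x'" "rel_index E x y = rel_index E x' y'"
      "rel_index E w y = rel_index E w y'"
    have tri: "(a = b \<and> b = c \<longrightarrow> a = c) \<and> (a = b \<and> a = c \<longrightarrow> b = c) \<and> (b = c \<and> a = c \<longrightarrow> a = b)"
      for a b c :: 's by auto
    \<comment> \<open>For a nonadjacent pair of distinct vertices, the relation says that exactly
      one coordinate agrees, but not which one. Transitivity of equality links these choices within
      a triple, so only a global exchange of \<open>f\<close> and \<open>g\<close> remains open; the
      second disjunct is that exchange, undone below by \<open>sw\<close>.\<close>
    have "(f w = f x \<longleftrightarrow> f w = f x') \<and> (f x = f y \<longleftrightarrow> f x' = f y') \<and> (f w = f y \<longleftrightarrow> f w = f y') \<and>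
        (g w = g x \<longleftrightarrow> g w = g x') \<and> (g x = g y \<longleftrightarrow> g x' = g y') \<and> (g w = g y \<longleftrightarrow> g w = g y')
      \<or> (g w = g x \<longleftrightarrow> f w = f x') \<and> (g x = g y \<longleftrightarrow> f x' = f y') \<and> (g w = g y \<longleftrightarrow> f w = f y') \<and>
        (f w = f x \<longleftrightarrow> g w = g x') \<and> (f x = f y \<longleftrightarrow> g x' = g y') \<and> (f w = f y \<longleftrightarrow> g w = g y')"
      using types tri[of "f w" "f x" "f y"] tri[of "g w" "g x" "g y"]
        tri[of "f w" "f x'" "f y'"] tri[of "g w" "g x'" "g y'"]
      unfolding rel_index_eq_iff E eq by sat
    then have "\<exists>k\<in>graph_automorphisms E. k w = w \<and> k x = x' \<and> k y = y'"
    proof (elim disjE conjE)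
      assume "g w = g x \<longleftrightarrow> f w = f x'" "g x = g y \<longleftrightarrow> f x' = f y'" "g w = g y \<longleftrightarrow> f w = f y'"
        "f w = f x \<longleftrightarrow> g w = g x'" "f x = f y \<longleftrightarrow> g x' = g y'" "f w = f y \<longleftrightarrow> g w = g y'"
      then have "\<exists>k\<in>graph_automorphisms E. k (sw w) = w \<and> k (sw x) = x' \<and> k (sw y) = y'"
        by (intro triple) (simp_all add: sw)
      then obtain k where "k \<in> graph_automorphisms E" "k (sw w) = w" "k (sw x) = x'" "k (sw y) = y'"
        by blast
      then show ?thesis by (intro bexI[of _ "k \<circ> sw"]) (auto intro: comp sw_aut)
    qed (rule triple)
    then show "\<exists>k\<in>vertex_stabilizer E w. k x = x' \<and> k y = y'"
      unfolding vertex_stabilizer_def by blast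
  qed
qed

subsection \<open>Bilinear forms graphs\<close>

text \<open>Rank one means that the two rows are multiples of one vector and not both zero.
  Conversely, vanishing minors make both rows multiples of a nonzero row.\<close>

lemma rank_eq_1_iff_minors:
  fixes X :: "'a::field ^ 'e::finite ^ 2"
  shows "rank X = 1 \<longleftrightarrow> X \<noteq> 0 \<and> (\<forall>k l. X $ 1 $ k * X $ 2 $ l = X $ 1 $ l * X $ 2 $ k)"
proof -
  have rows: "rows X = {X $ 1, X $ 2}"
    unfolding rows_def row_def UNIV_2 by auto
  have sgl: "vec.dim {u} = 1" if "u \<noteq> 0" for u :: "'a ^ 'e"
    using vec.dim_eq_card_independent[of "{u}"] that by (simp add: vec.independent_insert)
  show ?thesis
  proof (intro iffI conjI allI)
    fix k l
    assume "rank X = 1"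
    then have "vec.dim {X $ 1, X $ 2} = 1" unfolding row_rank_def_gen rows .
    then obtain b where "{X $ 1, X $ 2} \<subseteq> vec.span {b}"
      using vec.basis_exists[of "{X $ 1, X $ 2}"] by (metis card_1_singletonE)
    then obtain s t where "X $ 1 = s *s b" "X $ 2 = t *s b"
      by (auto simp: vec.span_singleton)
    then show "X $ 1 $ k * X $ 2 $ l = X $ 1 $ l * X $ 2 $ k" by simp
  next
    assume "rank X = 1"
    then have "vec.dim {X $ 1, X $ 2} = 1" unfolding row_rank_def_gen rows .
    moreover have "vec.dim {0 :: 'a ^ 'e} = 0" by simp
    ultimately show "X \<noteq> 0" by auto
  next
    assume X: "X \<noteq> 0 \<and> (\<forall>k l. X $ 1 $ k * X $ 2 $ l = X $ 1 $ l * X $ 2 $ k)"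
    then obtain i k where ik: "X $ i $ k \<noteq> 0" by (auto simp: vec_eq_iff)
    \<comment> \<open>The factor is read off in column \<open>k\<close>, where row \<open>i\<close>
      is nonzero; the minors through that column give the other entries.\<close>
    have "X $ j = (X $ j $ k / X $ i $ k) *s X $ i" for j
      using X ik exhaust_2[of i] exhaust_2[of j]
      by (auto simp: vec_eq_iff field_simps)
    then have "X $ j \<in> vec.span {X $ i}" for j
      unfolding vec.span_singleton by blast
    then have "vec.span {X $ 1, X $ 2} \<subseteq> vec.span {X $ i}"
      by (intro vec.span_minimal) auto
    moreover have "vec.span {X $ i} \<subseteq> vec.span {X $ 1, X $ 2}"
      using exhaust_2[of i] by (intro vec.span_mono) auto
    moreover have "X $ i \<noteq> 0" using ik by auto
    ultimately show "rank X = 1"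
      unfolding row_rank_def_gen rows by (metis vec.dim_span sgl subset_antisym)
  qed
qed

lemma bilinear_forms_graph_iff:
  "bilinear_forms_graph X Y \<longleftrightarrow> X \<noteq> Y \<and>
    (\<forall>k l. (X $ 1 $ k - Y $ 1 $ k) * (X $ 2 $ l - Y $ 2 $ l) =
           (X $ 1 $ l - Y $ 1 $ l) * (X $ 2 $ k - Y $ 2 $ k))"
  unfolding bilinear_forms_graph_def rank_eq_1_iff_minors by simp


section \<open>Cliques and common neighbours of triangles\<close>

text \<open>Over a field, these are the matrices whose column space lies in a fixed line, so any two
  of them differ by rank at most one.\<close>

definition row_clique :: "('a::zero ^ 'e::finite ^ 2) set" where
  "row_clique = {X. X $ 2 = 0}"

text \<open>The dual kind of clique: over a field, the row space lies in a fixed coordinate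
  line.\<close>

definition column_clique :: "'e::finite \<Rightarrow> ('a::zero ^ 'e ^ 2) set" where
  "column_clique i = {X. \<forall>r j. j \<noteq> i \<longrightarrow> X $ r $ j = 0}"

lemma card_row_clique: "card (row_clique :: ('a::{zero,finite} ^ 'e::finite ^ 2) set) = CARD('a) ^ CARD('e)"
proof -
  have "bij_betw (\<lambda>X. X $ 1) (row_clique :: ('a ^ 'e ^ 2) set) UNIV"
    by (rule bij_betw_byWitness[where f' = "\<lambda>v. \<chi> r. if r = 1 then v else 0"])
      (auto simp: row_clique_def vec_eq_iff forall_2)
  then show ?thesis by (simp add: bij_betw_same_card)
qed

lemma card_column_clique:
  "card (column_clique i :: ('a::{zero,finite} ^ 'e::finite ^ 2) set) = CARD('a) ^ 2"
proof -
  have "bij_betw (\<lambda>X. \<chi> r. X $ r $ i) (column_clique i :: ('a ^ 'e ^ 2) set) (UNIV :: ('a ^ 2) set)"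
    by (rule bij_betw_byWitness[where f' = "\<lambda>v. \<chi> r j. if j = i then v $ r else 0"])
      (auto simp: column_clique_def vec_eq_iff)
  then have "card (column_clique i :: ('a ^ 'e ^ 2) set) = CARD('a ^ 2)"
    by (rule bij_betw_same_card)
  then show ?thesis by simp
qed

definition unit_matrix :: "2 \<Rightarrow> 'e::finite \<Rightarrow> 'a::zero \<Rightarrow> 'a ^ 'e ^ 2" where
  "unit_matrix r i c = (\<chi> s j. if s = r \<and> j = i then c else 0)"

lemma bilinear_forms_graph_translate:
  "bilinear_forms_graph (W + X) (W + Y) \<longleftrightarrow> bilinear_forms_graph X Y"
  by (simp add: bilinear_forms_graph_def)

lemma bilinear_forms_graph_zero_left:
  "bilinear_forms_graph 0 X \<longleftrightarrow> X \<noteq> 0 \<and> (\<forall>k l. X $ 1 $ k * X $ 2 $ l = X $ 1 $ l * X $ 2 $ k)"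
  unfolding bilinear_forms_graph_iff by (auto simp: minus_mult_minus)

lemma common_neighbours_row_triangle:
  fixes i j :: "'e::finite"
  assumes "i \<noteq> j"
  defines "X \<equiv> unit_matrix 1 i (1::'a::{field,finite})" and "Y \<equiv> unit_matrix 1 j 1"
  shows "{Z. bilinear_forms_graph 0 Z \<and> bilinear_forms_graph X Z \<and> bilinear_forms_graph Y Z}
    = row_clique - {0, X, Y}"
proof (intro set_eqI iffI)
  fix Z
  assume "Z \<in> {Z. bilinear_forms_graph 0 Z \<and> bilinear_forms_graph X Z \<and> bilinear_forms_graph Y Z}"
  then have Z: "Z \<notin> {0, X, Y}"
    and 0: "\<And>k l. Z $ 1 $ k * Z $ 2 $ l = Z $ 1 $ l * Z $ 2 $ k"
    and 1: "\<And>k l. (X $ 1 $ k - Z $ 1 $ k) * (X $ 2 $ l - Z $ 2 $ l) =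
           (X $ 1 $ l - Z $ 1 $ l) * (X $ 2 $ k - Z $ 2 $ k)"
    and 2: "\<And>k l. (Y $ 1 $ k - Z $ 1 $ k) * (Y $ 2 $ l - Z $ 2 $ l) =
           (Y $ 1 $ l - Z $ 1 $ l) * (Y $ 2 $ k - Z $ 2 $ k)"
    unfolding bilinear_forms_graph_zero_left unfolding bilinear_forms_graph_iff by auto
  \<comment> \<open>Comparing the minors of \<open>Z\<close> and \<open>X - Z\<close> in columns
    \<open>i\<close> and \<open>l\<close> cancels the quadratic terms and leaves this equation for
    \<open>l \<noteq> i\<close>. The matrix \<open>Y\<close> does the same for
    \<open>l \<noteq> j\<close>, which covers \<open>l = i\<close>.\<close>
  have "Z $ 2 $ l = 0" for l
    using 0[of i l] 1[of i l] 0[of j l] 2[of j l] \<open>i \<noteq> j\<close>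
    by (cases "l = i") (auto simp: X_def Y_def unit_matrix_def algebra_simps)
  with Z show "Z \<in> row_clique - {0, X, Y}"
    by (simp add: row_clique_def vec_eq_iff)
next
  fix Z assume "Z \<in> row_clique - {0, X, Y}"
  then show "Z \<in> {Z. bilinear_forms_graph 0 Z \<and> bilinear_forms_graph X Z \<and> bilinear_forms_graph Y Z}"
    unfolding mem_Collect_eq bilinear_forms_graph_iff
    by (auto simp: row_clique_def X_def Y_def unit_matrix_def)
qed

lemma common_neighbours_column_triangle:
  fixes i :: "'e::finite"
  defines "X \<equiv> unit_matrix 1 i (1::'a::{field,finite})" and "Y \<equiv> unit_matrix 2 i 1"
  shows "{Z. bilinear_forms_graph 0 Z \<and> bilinear_forms_graph X Z \<and> bilinear_forms_graph Y Z}
    = column_clique i - {0, X, Y}"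
proof (intro set_eqI iffI)
  fix Z
  assume "Z \<in> {Z. bilinear_forms_graph 0 Z \<and> bilinear_forms_graph X Z \<and> bilinear_forms_graph Y Z}"
  then have Z: "Z \<notin> {0, X, Y}"
    and 0: "\<And>k l. Z $ 1 $ k * Z $ 2 $ l = Z $ 1 $ l * Z $ 2 $ k"
    and 1: "\<And>k l. (X $ 1 $ k - Z $ 1 $ k) * (X $ 2 $ l - Z $ 2 $ l) =
           (X $ 1 $ l - Z $ 1 $ l) * (X $ 2 $ k - Z $ 2 $ k)"
    and 2: "\<And>k l. (Y $ 1 $ k - Z $ 1 $ k) * (Y $ 2 $ l - Z $ 2 $ l) =
           (Y $ 1 $ l - Z $ 1 $ l) * (Y $ 2 $ k - Z $ 2 $ k)"
    unfolding bilinear_forms_graph_zero_left unfolding bilinear_forms_graph_iff by auto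
  \<comment> \<open>The same cancellation: \<open>X\<close> kills the lower entry of column
    \<open>l\<close>, and \<open>Y\<close> kills the upper one.\<close>
  have "Z $ 1 $ l = 0 \<and> Z $ 2 $ l = 0" if "l \<noteq> i" for l
    using 0[of i l] 1[of i l] 2[of i l] that
    by (auto simp: X_def Y_def unit_matrix_def algebra_simps)
  with Z show "Z \<in> column_clique i - {0, X, Y}"
    by (simp add: column_clique_def forall_2)
next
  fix Z assume "Z \<in> column_clique i - {0, X, Y}"
  then have Z: "Z \<notin> {0, X, Y}" and 0: "\<And>r k. k \<noteq> i \<Longrightarrow> Z $ r $ k = 0"
    by (auto simp: column_clique_def)
  have minors: "(A $ 1 $ k - Z $ 1 $ k) * (A $ 2 $ l - Z $ 2 $ l) =
           (A $ 1 $ l - Z $ 1 $ l) * (A $ 2 $ k - Z $ 2 $ k)" if "A \<in> {0, X, Y}" for A k l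
    using 0[of k] 0[of l] that
    by (cases "k = i"; cases "l = i") (auto simp: X_def Y_def unit_matrix_def)
  with Z show "Z \<in> {Z. bilinear_forms_graph 0 Z \<and> bilinear_forms_graph X Z \<and> bilinear_forms_graph Y Z}"
    using minors[of 0] minors[of X] minors[of Y] unfolding mem_Collect_eq bilinear_forms_graph_iff
    by (auto simp del: zero_index)
qed

text \<open>The matrices 0, \<open>X\<close> and \<open>Y\<close> are supported at a single entry,
  so they lie in a clique of each kind. Common neighbours therefore come from the row clique and
  also from outside it.\<close>

lemma common_neighbours_collinear_triple:
  fixes i :: "'e::finite" and c :: "'a::{field,finite}"
  defines "X \<equiv> unit_matrix 1 i 1" and "Y \<equiv> unit_matrix 1 i c"
  assumes "Z \<in> row_clique \<or> Z = unit_matrix 2 i 1" "Z \<notin> {0, X, Y}"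
  shows "bilinear_forms_graph 0 Z \<and> bilinear_forms_graph X Z \<and> bilinear_forms_graph Y Z"
  using assms(3,4) unfolding bilinear_forms_graph_iff
  by (auto simp: row_clique_def X_def Y_def unit_matrix_def)

section \<open>Necessity of \<open>q = e = 2\<close>\<close>

text \<open>Triple transitivity supplies some base vertex \<open>W\<close>. Translation by
  \<open>W\<close> carries the triangles through 0 to triangles through \<open>W\<close>, all of
  which have the same type.\<close>

lemma triply_transitive_bilinear_common_neighbours:
  fixes X Y X' Y' :: "'a::{field,finite} ^ 'e::finite ^ 2"
  assumes tt: "triply_transitive (bilinear_forms_graph :: 'a ^ 'e ^ 2 \<Rightarrow> _)"
    and "bilinear_forms_graph 0 X" "bilinear_forms_graph 0 Y" "bilinear_forms_graph X Y"
      "bilinear_forms_graph 0 X'" "bilinear_forms_graph 0 Y'" "bilinear_forms_graph X' Y'"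
  shows "card {Z. bilinear_forms_graph 0 Z \<and> bilinear_forms_graph X Z \<and> bilinear_forms_graph Y Z} =
    card {Z. bilinear_forms_graph 0 Z \<and> bilinear_forms_graph X' Z \<and> bilinear_forms_graph Y' Z}"
proof -
  let ?E = "bilinear_forms_graph :: 'a ^ 'e ^ 2 \<Rightarrow> _"
  obtain W where W: "\<And>X Y X' Y'. rel_index ?E W X = rel_index ?E W X' \<Longrightarrow>
      rel_index ?E X Y = rel_index ?E X' Y' \<Longrightarrow> rel_index ?E W Y = rel_index ?E W Y' \<Longrightarrow>
      card {Z. ?E W Z \<and> ?E X Z \<and> ?E Y Z} = card {Z. ?E W Z \<and> ?E X' Z \<and> ?E Y' Z}"
    using triply_transitive_card_common_neighbours[OF tt] by blast
  have shift: "card {Z. ?E W Z \<and> ?E (W + A) Z \<and> ?E (W + B) Z} = card {Z. ?E 0 Z \<and> ?E A Z \<and> ?E B Z}"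
    for A B
  proof -
    have nbr: "?E (W + A) Z \<longleftrightarrow> ?E A (Z - W)" for A Z
      using bilinear_forms_graph_translate[of W A "Z - W"] by simp
    have "{Z. ?E W Z \<and> ?E (W + A) Z \<and> ?E (W + B) Z} =
        {Z. ?E 0 (Z - W) \<and> ?E A (Z - W) \<and> ?E B (Z - W)}"
      using nbr[of 0] nbr[of A] nbr[of B] by simp
    also have "\<dots> = (+) W ` {Z. ?E 0 Z \<and> ?E A Z \<and> ?E B Z}"
    proof (intro set_eqI iffI)
      fix Z assume "Z \<in> {Z. ?E 0 (Z - W) \<and> ?E A (Z - W) \<and> ?E B (Z - W)}"
      then show "Z \<in> (+) W ` {Z. ?E 0 Z \<and> ?E A Z \<and> ?E B Z}"
        by (intro image_eqI[of _ _ "Z - W"]) simp_all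
    qed (elim imageE, simp)
    finally show ?thesis by (simp add: card_image)
  qed
  have adj: "rel_index ?E W (W + A) = rel_index ?E 0 A"
    "rel_index ?E (W + A) (W + B) = rel_index ?E A B" for A B
    using bilinear_forms_graph_translate[of W 0 A] bilinear_forms_graph_translate[of W A B]
    by (simp_all add: rel_index_def)
  have one: "rel_index ?E A B = 1" if "?E A B" for A B
    using that by (auto simp: rel_index_def bilinear_forms_graph_iff)
  have "card {Z. ?E W Z \<and> ?E (W + X) Z \<and> ?E (W + Y) Z} = card {Z. ?E W Z \<and> ?E (W + X') Z \<and> ?E (W + Y') Z}"
    by (rule W) (simp_all only: adj one assms)
  then show ?thesis unfolding shift .
qed

lemma bilinear_triply_transitive_imp:
  assumes tt: "triply_transitive (bilinear_forms_graph :: 'a::{field,finite} ^ 'e::finite ^ 2 \<Rightarrow> _)"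
    and e: "2 \<le> CARD('e)"
  shows "CARD('e) = 2" "CARD('a) = 2"
proof -
  let ?E = "bilinear_forms_graph :: 'a ^ 'e ^ 2 \<Rightarrow> _"
  define nb where "nb X Y = {Z. ?E 0 Z \<and> ?E X Z \<and> ?E Y Z}" for X Y
  obtain i j :: 'e where ij: "i \<noteq> j"
    using e card_le_Suc0_iff_eq[of "UNIV :: 'e set"] by force
  have q: "2 \<le> CARD('a)"
    using card_mono[of UNIV "{0, 1 :: 'a}"] by simp
  have unit_eq: "unit_matrix r k (b::'a) = unit_matrix s l c \<longleftrightarrow> b = 0 \<and> c = 0 \<or> r = s \<and> k = l \<and> b = c"
    for r k s and l :: 'e and b c
    by (auto simp: unit_matrix_def vec_eq_iff)
  have zero: "0 = unit_matrix 1 i (0::'a)"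
    by (simp add: unit_matrix_def vec_eq_iff)
  let ?x = "unit_matrix 1 i 1 :: 'a ^ 'e ^ 2" and ?y = "unit_matrix 1 j 1 :: 'a ^ 'e ^ 2"
    and ?z = "unit_matrix 2 i 1 :: 'a ^ 'e ^ 2"
  have adj: "?E 0 ?x" "?E 0 ?y" "?E 0 ?z" "?E ?x ?y" "?E ?x ?z"
    using ij unfolding bilinear_forms_graph_iff by (auto simp: zero unit_eq) (auto simp: unit_matrix_def)
  have cliq: "{0, ?x, ?y} \<subseteq> row_clique" "{0, ?x, ?z} \<subseteq> column_clique i"
    by (auto simp: row_clique_def column_clique_def unit_matrix_def vec_eq_iff)
  have row: "card (nb ?x ?y) = CARD('a) ^ CARD('e) - 3"
    unfolding nb_def common_neighbours_row_triangle[OF ij]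
    using ij by (subst card_Diff_subset[OF _ cliq(1)]) (auto simp: card_row_clique zero unit_eq)
  have "card (nb ?x ?z) = CARD('a) ^ 2 - 3"
    unfolding nb_def common_neighbours_column_triangle
    by (subst card_Diff_subset[OF _ cliq(2)]) (auto simp: card_column_clique zero unit_eq)
  moreover have "card (nb ?x ?y) = card (nb ?x ?z)"
    unfolding nb_def by (rule triply_transitive_bilinear_common_neighbours[OF tt]) (fact adj)+
  \<comment> \<open>Subtraction is truncated on the naturals; this bound makes it possible to cancel
    the 3 on both sides.\<close>
  moreover have "4 \<le> CARD('a) ^ 2" using power_mono[OF q, of 2] by simp
  moreover have "CARD('a) ^ 2 \<le> CARD('a) ^ CARD('e)" using q e by (intro power_increasing) auto
  ultimately have "CARD('a) ^ 2 = CARD('a) ^ CARD('e)" using row by linarith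
  then show "CARD('e) = 2" using q by (metis power_inject_exp Suc_1 Suc_le_lessD)
  show "CARD('a) = 2"
  proof (rule ccontr)
    assume "CARD('a) \<noteq> 2"
    then have "CARD('a) \<noteq> card {0, 1 :: 'a}" by simp
    then obtain c :: 'a where c: "c \<noteq> 0" "c \<noteq> 1" by (metis UNIV_eq_I insert_iff singletonD)
    \<comment> \<open>A third scalar gives a triangle inside a line. Its common neighbours include
      the rest of the row clique and also \<open>?z\<close>, one more than the triangle
      \<open>0\<close>, \<open>?x\<close>, \<open>?y\<close> has.\<close>
    let ?c = "unit_matrix 1 i c :: 'a ^ 'e ^ 2"
    have adj_c: "?E 0 ?c" "?E ?x ?c"
      using c unfolding bilinear_forms_graph_iff by (auto simp: zero unit_eq) (auto simp: unit_matrix_def)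
    have "?z \<notin> row_clique" by (auto simp: row_clique_def unit_matrix_def vec_eq_iff)
    moreover have sub: "{0, ?x, ?c} \<subseteq> row_clique"
      by (auto simp: row_clique_def unit_matrix_def vec_eq_iff)
    moreover have "card (row_clique - {0, ?x, ?c}) = CARD('a) ^ CARD('e) - 3"
      using c by (subst card_Diff_subset[OF _ sub]) (auto simp: card_row_clique zero unit_eq)
    ultimately have "card (insert ?z (row_clique - {0, ?x, ?c})) = Suc (CARD('a) ^ CARD('e) - 3)"
      by (subst card_insert_disjoint) auto
    moreover have "insert ?z (row_clique - {0, ?x, ?c}) \<subseteq> nb ?x ?c"
      using common_neighbours_collinear_triple[of _ i c] \<open>?z \<notin> row_clique\<close> sub
      unfolding nb_def by blast
    ultimately have "Suc (CARD('a) ^ CARD('e) - 3) \<le> card (nb ?x ?c)"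
      by (metis card_mono finite)
    moreover have "card (nb ?x ?y) = card (nb ?x ?c)"
      unfolding nb_def by (rule triply_transitive_bilinear_common_neighbours[OF tt]) (fact adj adj_c)+
    ultimately show False using row by simp
  qed
qed

text \<open>The nonsingular matrices of order 2 over the field with two elements are the nonzero elements
  of two complementary additive subgroups of order 4: the field generated by an element of order 3,
  and zero together with the three involutions. The coordinates \<open>f\<close> and \<open>g\<close> below are the
  quotient maps by these subgroups, so nonadjacency becomes equality of \<open>f\<close> or of \<open>g\<close>.\<close>

lemma triply_transitive_bilinear_2_2:
  assumes q: "CARD('a::{field,finite}) = 2" and e: "CARD('e::finite) = 2"
  shows "triply_transitive (bilinear_forms_graph :: 'a ^ 'e ^ 2 \<Rightarrow> _)"
proof -
  obtain i j :: 'e where ij: "UNIV = {i, j}" "i \<noteq> j" using e unfolding card_2_iff by blast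
  have "{0, 1 :: 'a} = UNIV" by (rule card_subset_eq) (simp_all add: q)
  then have F2: "x = 0 \<or> x = 1" for x :: 'a by blast
  have two: "2 = (0::'a)"
    using F2[of 2] one_add_one[where 'a = 'a] by (metis add_cancel_right_right zero_neq_one)
  define f :: "'a ^ 'e ^ 2 \<Rightarrow> 'a \<times> 'a"
    where "f X = (X $ 1 $ j + X $ 2 $ i, X $ 1 $ i + X $ 1 $ j + X $ 2 $ j)" for X
  define g :: "'a ^ 'e ^ 2 \<Rightarrow> 'a \<times> 'a"
    where "g X = (X $ 1 $ i + X $ 2 $ j, X $ 1 $ i + X $ 1 $ j + X $ 2 $ i)" for X
  have diff: "f (X - Y) = f X - f Y" "g (X - Y) = g X - g Y" for X Y
    by (simp_all add: f_def g_def algebra_simps)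
  have f0: "f X = f Y \<longleftrightarrow> f (X - Y) = 0" and g0: "g X = g Y \<longleftrightarrow> g (X - Y) = 0" for X Y
    by (simp_all add: diff)
  have alle: "(\<forall>k. P k) \<longleftrightarrow> P i \<and> P j" for P using ij by (metis UNIV_I insert_iff singleton_iff)
  \<comment> \<open>Over the field with two elements this and the next claim are checks of all
    sixteen matrices.\<close>
  have zero_iff: "D = 0 \<longleftrightarrow> f D = 0 \<and> g D = 0" for D
    using F2[of "D $ 1 $ i"] F2[of "D $ 1 $ j"] F2[of "D $ 2 $ i"] F2[of "D $ 2 $ j"]
    by (elim disjE) (simp_all add: vec_eq_iff forall_2 alle f_def g_def zero_prod_def two)
  have edge_iff: "rank D = 1 \<longleftrightarrow> f D \<noteq> 0 \<and> g D \<noteq> 0" for D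
    using F2[of "D $ 1 $ i"] F2[of "D $ 1 $ j"] F2[of "D $ 2 $ i"] F2[of "D $ 2 $ j"]
    unfolding rank_eq_1_iff_minors
    by (elim disjE) (simp_all add: vec_eq_iff forall_2 alle f_def g_def zero_prod_def two)
  show ?thesis
  proof (rule triply_transitive_rook_complement)
    have "inj (\<lambda>X. (f X, g X))"
      unfolding inj_def using f0 g0 zero_iff by (metis eq_iff_diff_eq_0 prod.inject)
    \<comment> \<open>Both sides have sixteen elements, so the injective coordinate map is
      onto.\<close>
    moreover have "CARD('a ^ 'e ^ 2) = CARD(('a \<times> 'a) \<times> ('a \<times> 'a))"
      by (simp add: q e)
    ultimately show "bij (\<lambda>X. (f X, g X))"
      unfolding bij_def by (metis card_image card_subset_eq finite subset_UNIV)
    show "bilinear_forms_graph X Y \<longleftrightarrow> f X \<noteq> f Y \<and> g X \<noteq> g Y" for X Y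
      unfolding bilinear_forms_graph_def edge_iff f0 g0 ..
    show "2 \<le> CARD('a \<times> 'a)" by (simp add: q)
  qed
qed

theorem theorem6p14:
  fixes q e :: nat
  assumes "primepow q" and "CARD('a::{field,finite}) = q"
    and "2 \<le> e" and "CARD('e::finite) = e"
  shows "triply_transitive (bilinear_forms_graph :: 'a ^ 'e ^ 2 \<Rightarrow> 'a ^ 'e ^ 2 \<Rightarrow> bool)
    \<longleftrightarrow> q = 2 \<and> e = 2"
  using bilinear_triply_transitive_imp[where 'a = 'a and 'e = 'e]
    triply_transitive_bilinear_2_2[where 'a = 'a and 'e = 'e] assms by auto

end
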